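(* Let $F$ be a free filter on $\omega$. Then the following are equivalent: (1) $N_F$ has the bounded Josefson--Nissenzweig property (BJNP); (2) there is a density ideal $I$ on $\omega$ such that $F\subseteq I^*$; (3) there is a non-pathological ideal $I$ on $\omega$ such that $F\subseteq I^*$; (4) $F\le_K\mathcal{Z}^*$, where $\mathcal{Z}$ is the asymptotic density ideal.
   Context: A filter $F$ on $\omega$ is free if $\bigcap F=\emptyset$ (equivalently, $F$ contains every cofinite set); filters are proper. For $S\subseteq\wp(\omega)$, $S^*=\{A\subseteq\omega: \omega\setminus A\in S\}$. An ideal on $\omega$ is a family $I$ such that $I^*$ is a (proper) filter. For a free filter $F$ on $\omega$, $N_F=\omega\cup\{p_F\}$, $p_F\notin\omega$, with the topology in which every point of $\omega$ is isolated and the open neighborhoods of $p_F$ are exactly the sets $A\cup\{p_F\}$ with $A\in F$. A finitely supported measure on a Tychonoff space $X$ is $\mu=\sum_{i=1}^n\alpha_i\delta_{x_i}$ with distinct $x_i\in X$ and $\alpha_i\in\mathbb{R}\setminus\{0\}$; $\|\mu\|=\sum_i|\alpha_i|$, $\mu(f)=\sum_i\alpha_i f(x_i)$. $X$ has the BJNP if there is a sequence $\langle\mu_n: n\in\omega\rangle$ of finitely supported measures on $X$ with $\|\mu_n\|=1$ for all $n$ and $\mu_n(f)\to0$ for every bounded continuous $f:X\to\mathbb{R}$. A submeasure on $\omega$ is $\varphi:\wp(\omega)\to[0,+\infty]$ with $\varphi(\emptyset)=0$, $\varphi(\{n\})<\infty$ for all $n$, and $\varphi(A)\le\varphi(A\cup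 B)\le\varphi(A)+\varphi(B)$. It is lower semi-continuous (lsc) if $\varphi(A)=\lim_{n\to\infty}\varphi(A\cap[0,n])$ for all $A$. For lsc $\varphi$, $\operatorname{Exh}(\varphi)=\{A\subseteq\omega:\lim_{n\to\infty}\varphi(A\setminus[0,n])=0\}$. $\varphi$ is non-pathological if for every $A\subseteq\omega$, $\varphi(A)=\sup\{\mu(A):\mu$ is a non-negative ($\sigma$-additive, finite) measure on $\wp(\omega)$ with $\mu(B)\le\varphi(B)$ for all $B\subseteq\omega\}$. An ideal $I$ on $\omega$ is non-pathological if $I=\operatorname{Exh}(\varphi)$ for some non-pathological lsc submeasure $\varphi$. A density submeasure is a submeasure of the form $\varphi=\sup_{n\in\omega}\mu_n$ for some sequence $\langle\mu_n\rangle$ of finitely supported non-negative measures on $\omega$ with pairwise disjoint supports; an ideal $I$ is a density ideal if $I=\operatorname{Exh}(\varphi)$ for some density submeasure $\varphi$. $\mathcal{Z}=\{A\subseteq\omega:\limsup_{n\to\infty}|A\cap[0,n)|/n=0\}$ (equivalently, $\mathcal Z=\operatorname{Exh}(\varphi_d)$ with $\varphi_d(A)=\sup_n|A\cap[2^n,2^{n+1})|/2^n$). For free filters $F,G$ on $\omega$, $F\le_K G$ means there is $f:\omega\to\omega$ such that $f^{-1}[A]\in G$ for every $A\in F$. *)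

theory Defs
  imports "HOL-Analysis.Analysis"
begin

section \<open>Filters and ideals on \<open>\<omega>\<close>\<close>

text \<open>
  Filters and ideals on \<open>\<omega>\<close> are families of subsets of \<^typ>\<open>nat\<close>.  The library predicate
  \<^const>\<open>is_filter\<close> speaks about predicates and admits the improper filter, which is excluded here.
\<close>

definition set_filter :: "nat set set \<Rightarrow> bool" where
  "set_filter F \<longleftrightarrow> is_filter (\<lambda>P. Collect P \<in> F) \<and> {} \<notin> F"

definition free_filter :: "nat set set \<Rightarrow> bool" where
  "free_filter F \<longleftrightarrow> set_filter F \<and> \<Inter>F = {}"

definition dual :: "nat set set \<Rightarrow> nat set set" where
  "dual S = {A. - A \<in> S}"

definition set_ideal :: "nat set set \<Rightarrow> bool" where
  "set_ideal I \<longleftrightarrow> set_filter (dual I)"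

definition katetov_le :: "nat set set \<Rightarrow> nat set set \<Rightarrow> bool" where
  "katetov_le F G \<longleftrightarrow> (\<exists>f::nat \<Rightarrow> nat. \<forall>A\<in>F. f -` A \<in> G)"


section \<open>The space \<open>N\<^sub>F\<close>\<close>

text \<open>
  The point \<open>n \<in> \<omega>\<close> is \<open>Some n\<close> and \<open>p\<^sub>F\<close> is \<open>None\<close>.  For a filter \<open>F\<close> the predicate below is
  indeed a topology, see \<open>openin_NF\<close>.
\<close>

definition NF :: "nat set set \<Rightarrow> nat option topology" where
  "NF F = topology (\<lambda>U. None \<in> U \<longrightarrow> (\<exists>A\<in>F. U = insert None (Some ` A)))"

lemma set_filterD:
  assumes "set_filter F"
  shows "UNIV \<in> F" and "{} \<notin> F"
    and "\<And>A B. A \<in> F \<Longrightarrow> B \<in> F \<Longrightarrow> A \<inter> B \<in> F"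
    and "\<And>A B. A \<in> F \<Longrightarrow> A \<subseteq> B \<Longrightarrow> B \<in> F"
proof -
  have F: "is_filter (\<lambda>P. Collect P \<in> F)" and "{} \<notin> F"
    using assms by (auto simp: set_filter_def)
  show "{} \<notin> F" by fact
  show "UNIV \<in> F" using is_filter.True[OF F] by simp
  show "A \<inter> B \<in> F" if "A \<in> F" "B \<in> F" for A B
    using is_filter.conj[OF F, of "\<lambda>x. x \<in> A" "\<lambda>x. x \<in> B"] that by (simp add: Int_def)
  show "B \<in> F" if "A \<in> F" "A \<subseteq> B" for A B
    using is_filter.mono[OF F, of "\<lambda>x. x \<in> A" "\<lambda>x. x \<in> B"] that by auto
qed

lemma NF_open_iff:
  "(\<exists>A\<in>F. U = insert None (Some ` A)) \<longleftrightarrow> None \<in> U \<and> Some -` U \<in> F"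
proof
  assume "\<exists>A\<in>F. U = insert None (Some ` A)"
  then obtain A where "A \<in> F" "U = insert None (Some ` A)" by blast
  moreover from this have "Some -` U = A" by auto
  ultimately show "None \<in> U \<and> Some -` U \<in> F" by simp
next
  assume *: "None \<in> U \<and> Some -` U \<in> F"
  have "x \<in> insert None (Some ` (Some -` U))" if "x \<in> U" for x
    using that by (cases x) auto
  with * have "U = insert None (Some ` (Some -` U))" by auto
  with * show "\<exists>A\<in>F. U = insert None (Some ` A)" by blast
qed

lemma openin_NF:
  assumes "set_filter F"
  shows "openin (NF F) U \<longleftrightarrow> (None \<in> U \<longrightarrow> (\<exists>A\<in>F. U = insert None (Some ` A)))"
proof -
  note F = set_filterD[OF assms]
  have "istopology (\<lambda>U. None \<in> U \<longrightarrow> (\<exists>A\<in>F. U = insert None (Some ` A)))"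
    unfolding istopology_def NF_open_iff
  proof (intro conjI allI impI)
    fix S T :: "nat option set"
    assume "None \<in> S \<longrightarrow> None \<in> S \<and> Some -` S \<in> F" "None \<in> T \<longrightarrow> None \<in> T \<and> Some -` T \<in> F"
      and "None \<in> S \<inter> T"
    then show "None \<in> S \<inter> T" "Some -` (S \<inter> T) \<in> F"
      using F(3) by auto
  next
    fix K :: "nat option set set"
    assume K: "\<forall>U\<in>K. None \<in> U \<longrightarrow> None \<in> U \<and> Some -` U \<in> F" and N: "None \<in> \<Union>K"
    then obtain U where "U \<in> K" "Some -` U \<in> F" by blast
    then show "Some -` \<Union>K \<in> F" by (rule_tac F(4)) auto
    show "None \<in> \<Union>K" by fact
  qed
  then show ?thesis
    by (simp add: NF_def topology_inverse')
qed

lemma topspace_NF: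
  assumes "set_filter F"
  shows "topspace (NF F) = UNIV"
proof -
  have "openin (NF F) UNIV"
    using set_filterD(1)[OF assms] by (simp add: openin_NF[OF assms] NF_open_iff)
  then show ?thesis
    using openin_subset by blast
qed


section \<open>Finitely supported measures and the bounded Josefson--Nissenzweig property\<close>

text \<open>
  The finitely supported measure \<open>\<Sum>i. \<alpha>\<^sub>i \<delta>\<^bsub>x\<^sub>i\<^esub>\<close> is represented by its weight function
  \<open>x\<^sub>i \<mapsto> \<alpha>\<^sub>i\<close>, which is zero at all other points.
\<close>

definition supp :: "('a \<Rightarrow> real) \<Rightarrow> 'a set" where
  "supp \<mu> = {x. \<mu> x \<noteq> 0}"

definition fs_measure :: "'a set \<Rightarrow> ('a \<Rightarrow> real) \<Rightarrow> bool" where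
  "fs_measure X \<mu> \<longleftrightarrow> finite (supp \<mu>) \<and> supp \<mu> \<subseteq> X"

definition fs_norm :: "('a \<Rightarrow> real) \<Rightarrow> real" where
  "fs_norm \<mu> = (\<Sum>x\<in>supp \<mu>. \<bar>\<mu> x\<bar>)"

definition fs_integral :: "('a \<Rightarrow> real) \<Rightarrow> ('a \<Rightarrow> real) \<Rightarrow> real" where
  "fs_integral \<mu> f = (\<Sum>x\<in>supp \<mu>. \<mu> x * f x)"

definition fs_value :: "('a \<Rightarrow> real) \<Rightarrow> 'a set \<Rightarrow> real" where
  "fs_value \<mu> A = (\<Sum>x\<in>supp \<mu> \<inter> A. \<mu> x)"

text \<open>
  The property is meant for Tychonoff spaces; \<open>N\<^sub>F\<close> is one for every free filter \<open>F\<close>, see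
  \<open>Tychonoff_NF\<close>.
\<close>

definition BJNP :: "'a topology \<Rightarrow> bool" where
  "BJNP X \<longleftrightarrow>
    (\<exists>\<mu> :: nat \<Rightarrow> 'a \<Rightarrow> real.
      (\<forall>n. fs_measure (topspace X) (\<mu> n) \<and> fs_norm (\<mu> n) = 1) \<and>
      (\<forall>f. continuous_map X euclideanreal f \<and> bounded (f ` topspace X) \<longrightarrow>
            (\<lambda>n. fs_integral (\<mu> n) f) \<longlonglongrightarrow> 0))"

lemma continuous_map_indicator_clopen:
  assumes "openin X S" "closedin X S"
  shows "continuous_map X euclideanreal (indicator S :: 'a \<Rightarrow> real)"
proof -
  have "openin X {x \<in> topspace X. (indicator S x :: real) \<in> U}" for U
  proof -
    have "{x \<in> topspace X. (indicator S x :: real) \<in> U} =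
        (if 1 \<in> U then S else {}) \<union> (if 0 \<in> U then topspace X - S else {})"
      using openin_subset[OF assms(1)] by (auto simp: indicator_def split: if_splits)
    then show ?thesis
      using assms by (auto simp: closedin_def)
  qed
  then show ?thesis
    by (simp add: continuous_map)
qed

lemma Tychonoff_NF:
  assumes "free_filter F"
  shows "completely_regular_space (NF F)" and "Hausdorff_space (NF F)"
proof -
  have F: "set_filter F" and fr: "\<Inter>F = {}"
    using assms by (auto simp: free_filter_def)
  note op = openin_NF[OF F, unfolded NF_open_iff] and ts = topspace_NF[OF F]
  have cof: "- {n} \<in> F" for n
  proof -
    obtain A where "A \<in> F" "n \<notin> A" using fr by blast
    then show ?thesis by (auto intro: set_filterD(4)[OF F, of A "- {n}"])
  qed
  have pt: "openin (NF F) {Some n}" "closedin (NF F) {Some n}" for n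
    using cof[of n] by (auto simp: closedin_def op ts vimage_def Compl_eq)
  show "completely_regular_space (NF F)"
    unfolding completely_regular_space_def
  proof (intro allI impI)
    fix S x assume S: "closedin (NF F) S \<and> x \<in> topspace (NF F) - S"
    obtain T where T: "openin (NF F) T" "closedin (NF F) T" "x \<notin> T" "S \<subseteq> T"
    proof (cases x)
      case None
      then have "openin (NF F) S" using S by (auto simp: op)
      with S None that[of S] show ?thesis by auto
    next
      case (Some n)
      with S that[of "UNIV - {Some n}"] pt[of n] show ?thesis
        by (auto simp: ts closedin_def Diff_Diff_Int)
    qed
    have "continuous_map (NF F) (top_of_set {0..1}) (indicator T :: _ \<Rightarrow> real)"
      using continuous_map_indicator_clopen[OF T(1,2)]
      by (auto simp: continuous_map_in_subtopology indicator_def)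
    then show "\<exists>f::nat option \<Rightarrow> real. continuous_map (NF F) (top_of_set {0..1}) f \<and> f x = 0 \<and> f ` S \<subseteq> {1}"
      using T(3,4) by (intro exI[of _ "indicator T"]) auto
  qed
  show "Hausdorff_space (NF F)"
    unfolding Hausdorff_space_def
  proof (intro allI impI)
    fix x y assume xy: "x \<in> topspace (NF F) \<and> y \<in> topspace (NF F) \<and> x \<noteq> y"
    have c: "openin (NF F) (UNIV - {Some n})" for n
      using pt(2)[of n] by (simp add: closedin_def ts)
    show "\<exists>U V. openin (NF F) U \<and> openin (NF F) V \<and> x \<in> U \<and> y \<in> V \<and> disjnt U V"
    proof (cases x)
      case None
      then obtain n where "y = Some n" using xy by (cases y) auto
      then show ?thesis using None pt(1)[of n] c[of n]
        by (intro exI[of _ "UNIV - {Some n}"] exI[of _ "{Some n}"]) (auto simp: disjnt_def)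
    next
      case (Some n)
      then show ?thesis using xy pt(1)[of n] c[of n]
        by (intro exI[of _ "{Some n}"] exI[of _ "UNIV - {Some n}"]) (auto simp: disjnt_def)
    qed
  qed
qed


section \<open>Submeasures and the ideals they determine\<close>

definition submeasure :: "(nat set \<Rightarrow> ennreal) \<Rightarrow> bool" where
  "submeasure \<phi> \<longleftrightarrow> \<phi> {} = 0 \<and> (\<forall>n. \<phi> {n} < \<infinity>) \<and>
    (\<forall>A B. \<phi> A \<le> \<phi> (A \<union> B) \<and> \<phi> (A \<union> B) \<le> \<phi> A + \<phi> B)"

definition lsc :: "(nat set \<Rightarrow> ennreal) \<Rightarrow> bool" where
  "lsc \<phi> \<longleftrightarrow> (\<forall>A. (\<lambda>n. \<phi> (A \<inter> {0..n})) \<longlonglongrightarrow> \<phi> A)"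

definition Exh :: "(nat set \<Rightarrow> ennreal) \<Rightarrow> nat set set" where
  "Exh \<phi> = {A. (\<lambda>n. \<phi> (A - {0..n})) \<longlonglongrightarrow> 0}"

definition nonpathological :: "(nat set \<Rightarrow> ennreal) \<Rightarrow> bool" where
  "nonpathological \<phi> \<longleftrightarrow>
    (\<forall>A. \<phi> A = Sup {emeasure M A | M :: nat measure.
       sets M = UNIV \<and> finite_measure M \<and> (\<forall>B. emeasure M B \<le> \<phi> B)})"

definition nonpathological_ideal :: "nat set set \<Rightarrow> bool" where
  "nonpathological_ideal I \<longleftrightarrow> set_ideal I \<and>
    (\<exists>\<phi>. submeasure \<phi> \<and> lsc \<phi> \<and> nonpathological \<phi> \<and> I = Exh \<phi>)"

definition density_submeasure :: "(nat set \<Rightarrow> ennreal) \<Rightarrow> bool" where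
  "density_submeasure \<phi> \<longleftrightarrow> submeasure \<phi> \<and>
    (\<exists>\<mu> :: nat \<Rightarrow> nat \<Rightarrow> real.
      (\<forall>n. fs_measure UNIV (\<mu> n) \<and> (\<forall>k. 0 \<le> \<mu> n k)) \<and>
      disjoint_family (\<lambda>n. supp (\<mu> n)) \<and>
      \<phi> = (\<lambda>A. SUP n. ennreal (fs_value (\<mu> n) A)))"

definition density_ideal :: "nat set set \<Rightarrow> bool" where
  "density_ideal I \<longleftrightarrow> set_ideal I \<and> (\<exists>\<phi>. density_submeasure \<phi> \<and> I = Exh \<phi>)"

definition asymptotic_density_ideal :: "nat set set" where
  "asymptotic_density_ideal =
    {A. limsup (\<lambda>n. ereal (real (card (A \<inter> {0..<n})) / real n)) = 0}"

end

theory Submission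
  imports Defs "HOL-Library.Discrete_Functions"
begin

text \<open>
  All four conditions are equivalent to the existence of finitely supported probability measures
  \<open>\<nu>\<^sub>n\<close> on \<open>\<omega>\<close> with \<open>\<nu>\<^sub>n(\<omega> - A) \<rightarrow> 0\<close> for every \<open>A \<in> F\<close>.  From the BJNP one takes the normalized
  variations of the measures restricted to \<open>\<omega>\<close>, using the Schur property of \<open>\<ell>\<^sub>1\<close>; conversely
  \<open>(\<nu>\<^sub>n - \<delta>\<^bsub>p\<^esub>) / 2\<close> witnesses the BJNP, where \<open>p = p\<^sub>F\<close>.  Since \<open>F\<close> is free, a gliding hump makes the \<open>\<nu>\<^sub>n\<close>
  disjointly supported, and their supremum is a density submeasure.  From a non-pathological
  \<open>\<phi>\<close> one takes measures below \<open>\<phi>\<close> that keep a fixed amount of mass on \<open>\<omega> - [0,n]\<close>.  Finally, a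
  Katetov map transports the uniform measures on \<open>[0,n]\<close> to such a sequence, and sampling the
  quantile functions of the \<open>\<nu>\<^sub>n\<close> along dyadic blocks produces a Katetov map.
\<close>

section \<open>Finitely supported measures on the natural numbers\<close>

lemma fs_value_superset:
  assumes "finite S" "supp \<mu> \<subseteq> S"
  shows "fs_value \<mu> A = sum \<mu> (S \<inter> A)"
  unfolding fs_value_def using assms by (intro sum.mono_neutral_left) (auto simp: supp_def)

lemma fs_integral_superset:
  assumes "finite S" "supp \<mu> \<subseteq> S"
  shows "fs_integral \<mu> f = (\<Sum>x\<in>S. \<mu> x * f x)"
  unfolding fs_integral_def using assms by (intro sum.mono_neutral_left) (auto simp: supp_def)

lemma fs_norm_superset:
  assumes "finite S" "supp \<mu> \<subseteq> S"
  shows "fs_norm \<mu> = (\<Sum>x\<in>S. \<bar>\<mu> x\<bar>)"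
  unfolding fs_norm_def using assms by (intro sum.mono_neutral_left) (auto simp: supp_def)

lemma fs_value_nonneg: "(\<And>k. 0 \<le> \<mu> k) \<Longrightarrow> 0 \<le> fs_value \<mu> A"
  unfolding fs_value_def by (intro sum_nonneg) auto

lemma fs_value_mono:
  assumes "finite (supp \<mu>)" "\<And>k. 0 \<le> \<mu> k" "supp \<mu> \<inter> A \<subseteq> B"
  shows "fs_value \<mu> A \<le> fs_value \<mu> B"
  unfolding fs_value_def using assms by (intro sum_mono2) auto

lemma fs_value_Un:
  assumes "finite (supp \<mu>)" "\<And>k. 0 \<le> \<mu> k"
  shows "fs_value \<mu> (A \<union> B) \<le> fs_value \<mu> A + fs_value \<mu> B"
proof -
  have "fs_value \<mu> (A \<union> B) = sum \<mu> ((supp \<mu> \<inter> A) \<union> (supp \<mu> \<inter> B))"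
    by (simp add: fs_value_def Int_Un_distrib)
  also have "\<dots> \<le> fs_value \<mu> A + fs_value \<mu> B"
    unfolding fs_value_def using assms by (subst sum_Un) (auto intro: sum_nonneg)
  finally show ?thesis .
qed

lemma fs_value_restrict:
  assumes "finite (supp \<mu>)"
  shows "fs_value (\<lambda>k. if k \<in> S then \<mu> k else 0) A = fs_value \<mu> (S \<inter> A)"
proof -
  have "fs_value (\<lambda>k. if k \<in> S then \<mu> k else 0) A = (\<Sum>k\<in>supp \<mu> \<inter> A. if k \<in> S then \<mu> k else 0)"
    using assms by (intro fs_value_superset) (auto simp: supp_def)
  also have "\<dots> = fs_value \<mu> (S \<inter> A)"
    unfolding fs_value_def using assms
    by (subst sum.inter_restrict[symmetric]) (auto intro!: sum.cong)
  finally show ?thesis .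
qed

text \<open>For a filter \<open>F\<close> these are the sequences of probability measures on the
  naturals that tend weakly to the point mass at \<open>None\<close> in \<open>NF F\<close>, phrased
  without the space.\<close>

definition concentrating :: "nat set set \<Rightarrow> (nat \<Rightarrow> nat \<Rightarrow> real) \<Rightarrow> bool" where
  "concentrating F \<nu> \<longleftrightarrow>
    (\<forall>n. finite (supp (\<nu> n)) \<and> (\<forall>k. 0 \<le> \<nu> n k) \<and> fs_value (\<nu> n) UNIV = 1) \<and>
    (\<forall>A\<in>F. (\<lambda>n. fs_value (\<nu> n) (- A)) \<longlonglongrightarrow> 0)"

text \<open>Dividing by masses that are at least \<open>c\<close> enlarges values by at most the
  factor \<open>1 / c\<close>, so the limits survive. It serves constructions that only yield a
  lower bound on the mass.\<close>

lemma concentrating_normalize: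
  assumes fin: "\<And>n. finite (supp (\<nu> n))" and nonneg: "\<And>n k. 0 \<le> \<nu> n k"
    and c: "0 < c" "\<And>n. c \<le> fs_value (\<nu> n) UNIV"
    and lim: "\<And>A. A \<in> F \<Longrightarrow> (\<lambda>n. fs_value (\<nu> n) (- A)) \<longlonglongrightarrow> 0"
  shows "\<exists>\<nu>. concentrating F \<nu>"
proof -
  define m where "m n = fs_value (\<nu> n) UNIV" for n
  have m: "0 < m n" "c \<le> m n" for n
    using c(1) c(2)[of n] by (auto simp: m_def)
  have supp: "supp (\<lambda>k. \<nu> n k / m n) = supp (\<nu> n)" for n
    using m(1)[of n] by (auto simp: supp_def)
  have val: "fs_value (\<lambda>k. \<nu> n k / m n) A = fs_value (\<nu> n) A / m n" for n A
    by (simp add: fs_value_def supp sum_divide_distrib)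
  have "(\<lambda>n. fs_value (\<nu> n) (- A) / m n) \<longlonglongrightarrow> 0" if "A \<in> F" for A
  proof (rule tendsto_sandwich[OF _ _ tendsto_const])
    show "(\<lambda>n. fs_value (\<nu> n) (- A) / c) \<longlonglongrightarrow> 0"
      using tendsto_divide[OF lim[OF that] tendsto_const[of c]] c(1) by simp
    show "\<forall>\<^sub>F n in sequentially. fs_value (\<nu> n) (- A) / m n \<le> fs_value (\<nu> n) (- A) / c"
      using m c(1) by (auto intro!: always_eventually divide_left_mono fs_value_nonneg nonneg)
    show "\<forall>\<^sub>F n in sequentially. 0 \<le> fs_value (\<nu> n) (- A) / m n"
      using m(1) by (auto intro!: always_eventually divide_nonneg_pos fs_value_nonneg nonneg)
  qed
  then have "concentrating F (\<lambda>n k. \<nu> n k / m n)"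
    unfolding concentrating_def supp val using fin nonneg m(1)
    by (auto simp: m_def[symmetric] less_imp_le less_imp_neq[symmetric])
  then show ?thesis by blast
qed

section \<open>Gliding humps and the Schur property\<close>

text \<open>Coordinatewise convergence makes the head on a fixed initial segment small at all late
  indices, some of which satisfy \<open>P\<close>; the finite support of the chosen vector then
  determines the next cut.\<close>

lemma gliding_hump:
  fixes x :: "nat \<Rightarrow> nat \<Rightarrow> real"
  assumes fin: "\<And>n. finite (supp (x n))" and lim: "\<And>k. (\<lambda>n. x n k) \<longlonglongrightarrow> 0"
    and freq: "\<exists>\<^sub>F n in sequentially. P n" and e: "0 < e"
  obtains r N where "strict_mono N" "N 0 = 0" "\<And>j. N j \<le> r j" "\<And>j. P (r j)"
    "\<And>j. supp (x (r j)) \<subseteq> {..<N (Suc j)}" "\<And>j. (\<Sum>k<N j. \<bar>x (r j) k\<bar>) < e"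
proof -
  have "\<exists>n\<ge>M. P n \<and> (\<Sum>k<M. \<bar>x n k\<bar>) < e" for M
  proof -
    have "(\<lambda>n. \<Sum>k<M. \<bar>x n k\<bar>) \<longlonglongrightarrow> (\<Sum>k<M. \<bar>0\<bar>)"
      by (intro tendsto_intros lim)
    then have "\<forall>\<^sub>F n in sequentially. (\<Sum>k<M. \<bar>x n k\<bar>) < e"
      using e by (intro order_tendstoD) auto
    then have "\<forall>\<^sub>F n in sequentially. M \<le> n \<and> (\<Sum>k<M. \<bar>x n k\<bar>) < e"
      using eventually_ge_at_top by (rule eventually_conj[rotated])
    from frequently_eventually_frequently[OF freq this] show ?thesis
      by (auto dest!: frequently_ex)
  qed
  then obtain s where s: "\<And>M. M \<le> s M" "\<And>M. P (s M)" "\<And>M. (\<Sum>k<M. \<bar>x (s M) k\<bar>) < e"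
    by metis
  have "\<exists>M'>M. supp (x (s M)) \<subseteq> {..<M'}" for M
  proof -
    obtain b where "\<forall>k\<in>supp (x (s M)). k \<le> b"
      using fin finite_nat_set_iff_bounded_le by blast
    then show ?thesis
      by (intro exI[of _ "Suc (max M b)"]) force
  qed
  then obtain g where g: "\<And>M. M < g M" "\<And>M. supp (x (s M)) \<subseteq> {..<g M}"
    by metis
  \<comment> \<open>Cut \<open>Suc j\<close> bounds the support of the vector chosen at cut
    \<open>j\<close>, so past its small head that vector lives in block \<open>j\<close>.\<close>
  define N where "N j = (g ^^ j) 0" for j
  have N: "N 0 = 0" "N (Suc j) = g (N j)" for j
    by (simp_all add: N_def)
  show thesis
    by (rule that[of N "\<lambda>j. s (N j)"]) (auto simp: strict_mono_Suc_iff N g s dest: subsetD[OF g(2)])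
qed

text \<open>The least \<open>j\<close> with \<open>k < N (Suc j)\<close> is the block of
  \<open>k\<close>. The index serves to glue one function from blockwise pieces and to see that
  blocks are disjoint.\<close>

lemma strict_mono_block_index:
  fixes N :: "nat \<Rightarrow> nat"
  assumes "strict_mono N" "N 0 = 0"
  obtains i where "\<And>j k. N j \<le> k \<Longrightarrow> k < N (Suc j) \<Longrightarrow> i k = j"
proof
  fix j k assume jk: "N j \<le> k" "k < N (Suc j)"
  show "(LEAST j. k < N (Suc j)) = j"
  proof (rule Least_equality)
    show "k < N (Suc j)" by fact
    fix j' assume "k < N (Suc j')"
    then have "N j < N (Suc j')" using jk by simp
    then show "j \<le> j'" using assms(1) by (simp add: strict_mono_less)
  qed
qed

text \<open>Finite supports spare the usual tail estimate: only the head of each hump must be made small.\<close>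

lemma schur_property:
  fixes x :: "nat \<Rightarrow> nat \<Rightarrow> real"
  assumes fin: "\<And>n. finite (supp (x n))"
    and weak: "\<And>f. bounded (range f) \<Longrightarrow> (\<lambda>n. fs_integral (x n) f) \<longlonglongrightarrow> 0"
  shows "(\<lambda>n. fs_norm (x n)) \<longlonglongrightarrow> 0"
proof (rule ccontr)
  assume "\<not> ?thesis"
  moreover have nn: "0 \<le> fs_norm (x n)" for n by (simp add: fs_norm_def sum_nonneg)
  ultimately obtain e where e: "0 < e" "\<exists>\<^sub>F n in sequentially. e \<le> fs_norm (x n)"
    by (auto simp: tendsto_iff not_eventually not_less)
  \<comment> \<open>Testing against indicators of points turns weak into coordinatewise convergence,
    as the gliding hump requires.\<close>
  have lim: "(\<lambda>n. x n k) \<longlonglongrightarrow> 0" for k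
  proof -
    have "bounded (range (\<lambda>i. of_bool (i = k) :: real))"
      by (auto simp: bounded_iff intro!: exI[of _ 1])
    moreover have "fs_integral (x n) (\<lambda>i. of_bool (i = k)) = x n k" for n
      using fs_integral_superset[of "insert k (supp (x n))" "x n"] fin
      by (simp add: subset_insertI if_distrib cong: if_cong)
    ultimately show ?thesis using weak[of "\<lambda>i. of_bool (i = k)"] by simp
  qed
  obtain r N where N: "strict_mono N" "N 0 = 0" and r: "\<And>j. N j \<le> r j"
    "\<And>j. e \<le> fs_norm (x (r j))" "\<And>j. supp (x (r j)) \<subseteq> {..<N (Suc j)}"
    "\<And>j. (\<Sum>k<N j. \<bar>x (r j) k\<bar>) < e / 4"
    by (rule gliding_hump[OF fin lim e(2), of "e / 4"]) (use e in auto)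
  obtain i where i: "\<And>j k. N j \<le> k \<Longrightarrow> k < N (Suc j) \<Longrightarrow> i k = j"
    using strict_mono_block_index[OF N] by blast
  \<comment> \<open>On block \<open>j\<close> the test function copies the signs of the vector
    \<open>x (r j)\<close>.\<close>
  define f where "f k = sgn (x (r (i k)) k)" for k
  have f1: "\<bar>f k\<bar> \<le> 1" for k by (simp add: f_def abs_sgn_eq)
  \<comment> \<open>The head weighs less than \<open>e / 4\<close>, so block \<open>j\<close>
    contributes more than \<open>3 * e / 4\<close> to the integral, of which the head cancels at
    most \<open>e / 4\<close>.\<close>
  have big: "e / 2 \<le> fs_integral (x (r j)) f" for j
  proof -
    let ?y = "x (r j)"
    have split: "{..<N (Suc j)} = {..<N j} \<union> {N j..<N (Suc j)}" "{..<N j} \<inter> {N j..<N (Suc j)} = {}"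
      using strict_monoD[OF N(1), of j "Suc j"] by auto
    have "fs_norm ?y = (\<Sum>k<N j. \<bar>?y k\<bar>) + (\<Sum>k\<in>{N j..<N (Suc j)}. \<bar>?y k\<bar>)"
      using fs_norm_superset[OF _ r(3)] split by (simp add: sum.union_disjoint)
    moreover have "fs_integral ?y f = (\<Sum>k<N j. ?y k * f k) + (\<Sum>k\<in>{N j..<N (Suc j)}. ?y k * f k)"
      using fs_integral_superset[OF _ r(3)] split by (simp add: sum.union_disjoint)
    moreover have "(\<Sum>k\<in>{N j..<N (Suc j)}. ?y k * f k) = (\<Sum>k\<in>{N j..<N (Suc j)}. \<bar>?y k\<bar>)"
      by (intro sum.cong) (auto simp: f_def i abs_sgn)
    moreover have "\<bar>\<Sum>k<N j. ?y k * f k\<bar> \<le> (\<Sum>k<N j. \<bar>?y k\<bar>)"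
      using f1 by (intro order.trans[OF sum_abs] sum_mono) (simp add: abs_mult mult_left_le)
    ultimately show ?thesis using r(2,4)[of j] by linarith
  qed
  have "(\<lambda>n. fs_integral (x n) f) \<longlonglongrightarrow> 0"
    using f1 by (intro weak) (auto simp: bounded_iff)
  \<comment> \<open>Since \<open>r\<close> dominates the strictly increasing \<open>N\<close>, it
    tends to infinity, and the weak limit passes along \<open>r\<close>.\<close>
  moreover have "filterlim r sequentially sequentially"
  proof (rule filterlim_at_top_mono)
    show "filterlim N sequentially sequentially" using N(1) by (rule filterlim_subseq)
  qed (simp add: r)
  ultimately have "(\<lambda>j. fs_integral (x (r j)) f) \<longlonglongrightarrow> 0"
    by (rule filterlim_compose)
  then have "e / 2 \<le> 0"
    using big by (intro LIMSEQ_le_const) auto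
  with e show False by simp
qed

section \<open>Concentrating sequences and the space \<open>N\<^sub>F\<close>\<close>

text \<open>All other points being isolated, continuity is a condition at \<open>None\<close> alone:
  convergence of \<open>f\<close> to \<open>f None\<close> along \<open>F\<close>.\<close>

lemma continuous_map_NF:
  assumes "set_filter F"
  shows "continuous_map (NF F) euclideanreal f \<longleftrightarrow> (\<forall>e>0. {k. \<bar>f (Some k) - f None\<bar> < e} \<in> F)"
proof
  assume L: "continuous_map (NF F) euclideanreal f"
  show "\<forall>e>0. {k. \<bar>f (Some k) - f None\<bar> < e} \<in> F"
  proof (intro allI impI)
    fix e :: real assume "0 < e"
    have "openin (NF F) {x \<in> topspace (NF F). f x \<in> ball (f None) e}"
      by (rule openin_continuous_map_preimage[OF L]) auto
    then have "Some -` {x. f x \<in> ball (f None) e} \<in> F"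
      using \<open>0 < e\<close> by (simp add: openin_NF[OF assms] NF_open_iff topspace_NF[OF assms])
    then show "{k. \<bar>f (Some k) - f None\<bar> < e} \<in> F"
      by (simp add: vimage_def dist_real_def abs_minus_commute)
  qed
next
  assume R: "\<forall>e>0. {k. \<bar>f (Some k) - f None\<bar> < e} \<in> F"
  show "continuous_map (NF F) euclideanreal f"
    unfolding continuous_map openin_NF[OF assms] NF_open_iff topspace_NF[OF assms]
  proof (intro conjI allI impI)
    fix U assume "openin euclideanreal U" and N: "None \<in> {x \<in> UNIV. f x \<in> U}"
    then obtain e where e: "0 < e" "ball (f None) e \<subseteq> U"
      by (auto simp: open_contains_ball)
    show "Some -` {x \<in> UNIV. f x \<in> U} \<in> F"
      by (rule set_filterD(4)[OF assms R[rule_format, OF e(1)]])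
        (use e(2) in \<open>auto simp: subset_iff dist_real_def abs_minus_commute\<close>)
  qed auto
qed

text \<open>This splits off the point \<open>None\<close>. As \<open>h\<close> vanishes wherever
  \<open>\<mu>\<close> does, the term \<open>h None\<close> may be added whether or not
  \<open>None\<close> lies in the support.\<close>

lemma sum_supp_option:
  assumes fin: "finite (supp \<mu>)" and zero: "\<And>x. \<mu> x = 0 \<Longrightarrow> h x = 0"
  shows "(\<Sum>x\<in>supp \<mu>. h x) = h None + (\<Sum>k\<in>supp (\<lambda>k. \<mu> (Some k)). h (Some k))"
    and "finite (supp (\<lambda>k. \<mu> (Some k)))"
proof -
  let ?S = "supp (\<lambda>k. \<mu> (Some k))"
  have S: "Some -` supp \<mu> = ?S" by (auto simp: supp_def)
  show fS: "finite ?S"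
    unfolding S[symmetric] by (rule finite_vimageI[OF fin]) simp
  have "supp \<mu> \<subseteq> insert None (Some ` ?S)"
  proof
    fix x assume "x \<in> supp \<mu>"
    then show "x \<in> insert None (Some ` ?S)" by (cases x) (auto simp: supp_def)
  qed
  then have "(\<Sum>x\<in>supp \<mu>. h x) = (\<Sum>x\<in>insert None (Some ` ?S). h x)"
    using fS zero by (intro sum.mono_neutral_left) (auto simp: supp_def)
  also have "\<dots> = h None + (\<Sum>k\<in>?S. h (Some k))"
    using fS by (simp add: sum.reindex image_iff)
  finally show "(\<Sum>x\<in>supp \<mu>. h x) = h None + (\<Sum>k\<in>?S. h (Some k))" .
qed

text \<open>
  Functions vanishing on some \<open>A \<in> F\<close> and at \<open>p\<^sub>F\<close> are continuous, so the measures restricted to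
  \<open>\<omega> - A\<close> converge weakly, hence in norm.  The mass at \<open>p\<^sub>F\<close> cannot exceed about \<open>1/2\<close>, because the
  integral of the constant function tends to \<open>0\<close>.
\<close>

lemma BJNP_NF_imp_concentrating:
  assumes F: "set_filter F" and "BJNP (NF F)"
  shows "\<exists>\<nu>. concentrating F \<nu>"
proof -
  obtain \<mu> :: "nat \<Rightarrow> nat option \<Rightarrow> real" where
    fin: "\<And>n. finite (supp (\<mu> n))" and norm1: "\<And>n. fs_norm (\<mu> n) = 1" and
    weak: "\<And>f. continuous_map (NF F) euclideanreal f \<Longrightarrow> bounded (range f) \<Longrightarrow>
            (\<lambda>n. fs_integral (\<mu> n) f) \<longlonglongrightarrow> 0"
    using assms(2) unfolding BJNP_def topspace_NF[OF F] fs_measure_def by blast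
  define l where "l n = (\<lambda>k. \<mu> n (Some k))" for n
  have finl: "finite (supp (l n))" for n
    using sum_supp_option(2)[OF fin, where h="\<lambda>_. 0"] by (simp add: l_def)
  have integral: "fs_integral (\<mu> n) f = \<mu> n None * f None + fs_integral (l n) (\<lambda>k. f (Some k))" for n f
    unfolding fs_integral_def by (subst sum_supp_option(1)[OF fin]) (auto simp: l_def)
  have norm: "fs_norm (\<mu> n) = \<bar>\<mu> n None\<bar> + fs_norm (l n)" for n
    unfolding fs_norm_def by (subst sum_supp_option(1)[OF fin]) (auto simp: l_def)
  \<comment> \<open>The variation on \<open>B\<close> becomes the norm of a restriction, the form to
    which \<open>schur_property\<close> applies.\<close>
  have val: "fs_value (\<lambda>k. \<bar>l n k\<bar>) B = fs_norm (\<lambda>k. if k \<in> B then l n k else 0)" for n B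
  proof -
    have "fs_norm (\<lambda>k. if k \<in> B then l n k else 0) = (\<Sum>k\<in>supp (l n) \<inter> B. \<bar>if k \<in> B then l n k else 0\<bar>)"
      using finl[of n] by (intro fs_norm_superset) (auto simp: supp_def)
    then show ?thesis by (simp add: fs_value_def supp_def)
  qed
  have small: "(\<lambda>n. fs_value (\<lambda>k. \<bar>l n k\<bar>) (- A)) \<longlonglongrightarrow> 0" if A: "A \<in> F" for A
    unfolding val
  proof (rule schur_property)
    show "finite (supp (\<lambda>k. if k \<in> - A then l n k else 0))" for n
      using finl[of n] by (rule rev_finite_subset) (auto simp: supp_def)
    fix f :: "nat \<Rightarrow> real" assume f: "bounded (range f)"
    define g where "g x = (case x of None \<Rightarrow> 0 | Some k \<Rightarrow> if k \<in> A then 0 else f k)" for x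
    have "continuous_map (NF F) euclideanreal g"
      unfolding continuous_map_NF[OF F]
      by (intro allI impI set_filterD(4)[OF F A]) (auto simp: g_def)
    moreover have "bounded (range g)"
      by (rule bounded_subset[of "insert 0 (range f)"]) (use f in \<open>auto simp: g_def split: option.splits\<close>)
    ultimately have "(\<lambda>n. fs_integral (\<mu> n) g) \<longlonglongrightarrow> 0" by (rule weak)
    moreover have "fs_integral (\<mu> n) g = fs_integral (\<lambda>k. if k \<in> - A then l n k else 0) f" for n
    proof -
      have "fs_integral (\<lambda>k. if k \<in> - A then l n k else 0) f =
          (\<Sum>k\<in>supp (l n). (if k \<in> - A then l n k else 0) * f k)"
        using finl[of n] by (intro fs_integral_superset) (auto simp: supp_def)
      also have "\<dots> = fs_integral (\<mu> n) g"
        unfolding integral by (auto simp: g_def fs_integral_def intro!: sum.cong)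
      finally show ?thesis ..
    qed
    ultimately show "(\<lambda>n. fs_integral (\<lambda>k. if k \<in> - A then l n k else 0) f) \<longlonglongrightarrow> 0" by simp
  qed
  have "(\<lambda>n. fs_integral (\<mu> n) (\<lambda>_. 1)) \<longlonglongrightarrow> 0"
    using set_filterD(1)[OF F] by (intro weak) (auto simp: continuous_map_NF[OF F])
  then have "\<forall>\<^sub>F n in sequentially. \<bar>fs_integral (\<mu> n) (\<lambda>_. 1)\<bar> < 1 / 2"
    by (auto simp: tendsto_iff dest!: spec[of _ "1 / 2"])
  then obtain n0 where n0: "\<And>n. n0 \<le> n \<Longrightarrow> \<bar>fs_integral (\<mu> n) (\<lambda>_. 1)\<bar> < 1 / 2"
    by (auto simp: eventually_sequentially)
  \<comment> \<open>With \<open>a\<close> the mass at \<open>None\<close> and \<open>b\<close> the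
    norm of \<open>l n\<close>, the bounds \<open>\<bar>a\<bar> < 1 / 2 + b\<close> and
    \<open>\<bar>a\<bar> + b = 1\<close> force \<open>b > 1 / 4\<close>.\<close>
  have big: "1 / 4 \<le> fs_value (\<lambda>k. \<bar>l n k\<bar>) UNIV" if "n0 \<le> n" for n
  proof -
    have "\<bar>\<mu> n None + fs_integral (l n) (\<lambda>_. 1)\<bar> < 1 / 2"
      using n0[OF that] by (simp add: integral)
    moreover have "\<bar>fs_integral (l n) (\<lambda>_. 1)\<bar> \<le> fs_norm (l n)"
      unfolding fs_integral_def fs_norm_def by (simp add: sum_abs)
    moreover have "\<bar>\<mu> n None\<bar> + fs_norm (l n) = 1"
      using norm norm1 by simp
    ultimately have "1 / 4 \<le> fs_norm (l n)" by linarith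
    then show ?thesis by (simp add: val)
  qed
  \<comment> \<open>The lower bound on the mass holds from \<open>n0\<close> on, hence the shift of
    the index.\<close>
  show ?thesis
  proof (rule concentrating_normalize)
    show "1 / 4 \<le> fs_value (\<lambda>k. \<bar>l (n + n0) k\<bar>) UNIV" for n using big by simp
    show "(\<lambda>n. fs_value (\<lambda>k. \<bar>l (n + n0) k\<bar>) (- A)) \<longlonglongrightarrow> 0" if "A \<in> F" for A
      using LIMSEQ_ignore_initial_segment[OF small[OF that], of n0] .
    show "finite (supp (\<lambda>k. \<bar>l (n + n0) k\<bar>))" for n using finl[of "n + n0"] by (simp add: supp_def)
  qed auto
qed

text \<open>Integrating against half the difference of \<open>\<nu> n\<close> and the point mass at
  \<open>None\<close> averages \<open>(f k - f None) / 2\<close>: small on a set of \<open>F\<close>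
  by continuity, bounded on its complement, whose measure vanishes.\<close>

lemma concentrating_imp_BJNP_NF:
  assumes F: "set_filter F" and conc: "concentrating F \<nu>"
  shows "BJNP (NF F)"
proof -
  have fin: "finite (supp (\<nu> n))" and nonneg: "0 \<le> \<nu> n k" and one: "fs_value (\<nu> n) UNIV = 1"
    and lim: "A \<in> F \<Longrightarrow> (\<lambda>n. fs_value (\<nu> n) (- A)) \<longlonglongrightarrow> 0" for n k A
    using conc by (auto simp: concentrating_def)
  define \<mu> where "\<mu> n x = (case x of None \<Rightarrow> - 1 / 2 | Some k \<Rightarrow> \<nu> n k / 2)" for n x
  have suppS: "supp (\<lambda>k. \<mu> n (Some k)) = supp (\<nu> n)" for n
    by (simp add: \<mu>_def supp_def)
  have "supp (\<mu> n) \<subseteq> insert None (Some ` supp (\<nu> n))" for n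
  proof
    fix x assume "x \<in> supp (\<mu> n)"
    then show "x \<in> insert None (Some ` supp (\<nu> n))" by (cases x) (auto simp: supp_def \<mu>_def)
  qed
  then have fin\<mu>: "finite (supp (\<mu> n))" for n
    using fin by (meson finite.insertI finite_imageI finite_subset)
  have norm: "fs_norm (\<mu> n) = 1" for n
  proof -
    have "fs_norm (\<mu> n) = 1 / 2 + fs_value (\<nu> n) UNIV / 2"
      unfolding fs_norm_def by (subst sum_supp_option(1)[OF fin\<mu>], simp)
        (simp add: suppS, simp add: \<mu>_def fs_value_def nonneg sum_divide_distrib)
    then show ?thesis by (simp add: one)
  qed
  have "(\<lambda>n. fs_integral (\<mu> n) f) \<longlonglongrightarrow> 0"
    if cont: "continuous_map (NF F) euclideanreal f" and bdd: "bounded (range f)" for f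
  proof -
    obtain C where C: "0 < C" "\<And>x. \<bar>f x\<bar> \<le> C"
      using bdd by (auto simp: bounded_pos)
    have int: "fs_integral (\<mu> n) f = (\<Sum>k\<in>supp (\<nu> n). \<nu> n k * (f (Some k) - f None)) / 2" for n
    proof -
      have "fs_integral (\<mu> n) f = - f None / 2 + (\<Sum>k\<in>supp (\<nu> n). \<nu> n k * f (Some k)) / 2"
        unfolding fs_integral_def by (subst sum_supp_option(1)[OF fin\<mu>], simp)
          (simp add: suppS, simp add: \<mu>_def sum_divide_distrib)
      moreover have "(\<Sum>k\<in>supp (\<nu> n). \<nu> n k * f None) = f None"
        using one[of n] by (simp add: fs_value_def flip: sum_distrib_right)
      ultimately show ?thesis by (simp add: right_diff_distrib sum_subtractf diff_divide_distrib)
    qed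
    show ?thesis
    proof (rule LIMSEQ_I)
      fix e :: real assume e: "0 < e"
      define A where "A = {k. \<bar>f (Some k) - f None\<bar> < e}"
      have "A \<in> F" using cont e by (simp add: continuous_map_NF[OF F] A_def)
      from LIMSEQ_D[OF lim[OF this], of "e / (2 * C)"] obtain n0 where
        n0: "\<And>n. n0 \<le> n \<Longrightarrow> \<bar>fs_value (\<nu> n) (- A)\<bar> < e / (2 * C)"
        using e C by auto
      have "\<bar>fs_integral (\<mu> n) f\<bar> < e" if n: "n0 \<le> n" for n
      proof -
        \<comment> \<open>The integrand is below \<open>e\<close> on \<open>A\<close> and at most
          \<open>2 * C\<close> off \<open>A\<close>. By the choice of \<open>e / (2 * C)\<close> the
          total is below \<open>2 * e\<close>, which the factor 1/2 in \<open>int\<close> turns into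
          \<open>e\<close>.\<close>
        have "\<bar>\<Sum>k\<in>supp (\<nu> n). \<nu> n k * (f (Some k) - f None)\<bar> \<le>
            (\<Sum>k\<in>supp (\<nu> n). \<nu> n k * e + (if k \<in> - A then \<nu> n k * (2 * C) else 0))"
        proof (intro order.trans[OF sum_abs] sum_mono)
          fix k
          have "\<bar>f (Some k) - f None\<bar> \<le> e + (if k \<in> - A then 2 * C else 0)"
            using C(2)[of "Some k"] C(2)[of None] e by (auto simp: A_def)
          from mult_left_mono[OF this nonneg[of n k]]
          show "\<bar>\<nu> n k * (f (Some k) - f None)\<bar> \<le>
              \<nu> n k * e + (if k \<in> - A then \<nu> n k * (2 * C) else 0)"
            using nonneg[of n k] by (auto simp: abs_mult distrib_left)
        qed
        also have "\<dots> = e * fs_value (\<nu> n) UNIV + 2 * C * fs_value (\<nu> n) (- A)"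
          using fin[of n] unfolding sum.distrib fs_value_def
          by (subst sum.inter_restrict[symmetric]) (auto simp: sum_distrib_left mult_ac)
        also have "\<dots> < e + 2 * C * (e / (2 * C))"
          unfolding one using n0[OF n] C(1) by (intro add_le_less_mono mult_strict_left_mono) auto
        finally show ?thesis using C(1) by (simp add: int)
      qed
      then show "\<exists>n0. \<forall>n\<ge>n0. norm (fs_integral (\<mu> n) f - 0) < e" by auto
    qed
  qed
  then show ?thesis
    unfolding BJNP_def topspace_NF[OF F] fs_measure_def using fin\<mu> norm by blast
qed

section \<open>Concentrating sequences and ideals\<close>

lemma ennreal_real_between:
  assumes "(0::ennreal) < a"
  obtains e where "0 < e" "ennreal e < a"
proof -
  obtain b where b: "0 < b" "b < a" using dense[OF assms] by blast
  show thesis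
  proof (cases b)
    case (real e)
    with b that[of e] show thesis by simp
  qed (use b in simp)
qed

text \<open>Monotonicity and subadditivity of \<open>\<phi>\<close>, applied to tails, give closure
  under subsets and unions; the second assumption is properness.\<close>

lemma set_ideal_Exh:
  assumes "submeasure \<phi>" "UNIV \<notin> Exh \<phi>"
  shows "set_ideal (Exh \<phi>)"
proof -
  have mono: "A \<subseteq> B \<Longrightarrow> \<phi> A \<le> \<phi> B" for A B
    using assms(1) unfolding submeasure_def by (metis Un_absorb1)
  have Un: "\<phi> (A \<union> B) \<le> \<phi> A + \<phi> B" and empty: "\<phi> {} = 0" for A B
    using assms(1) unfolding submeasure_def by auto
  have down: "A \<in> Exh \<phi>" if "B \<in> Exh \<phi>" "A \<subseteq> B" for A B
    unfolding Exh_def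
  proof (safe, rule tendsto_sandwich[OF _ _ tendsto_const])
    show "(\<lambda>n. \<phi> (B - {0..n})) \<longlonglongrightarrow> 0" using that(1) by (simp add: Exh_def)
    show "\<forall>\<^sub>F n in sequentially. \<phi> (A - {0..n}) \<le> \<phi> (B - {0..n})"
      using that(2) by (intro always_eventually allI mono) auto
  qed simp
  have union: "A \<union> B \<in> Exh \<phi>" if "A \<in> Exh \<phi>" "B \<in> Exh \<phi>" for A B
    unfolding Exh_def
  proof (safe, rule tendsto_sandwich[OF _ _ tendsto_const])
    show "(\<lambda>n. \<phi> (A - {0..n}) + \<phi> (B - {0..n})) \<longlonglongrightarrow> 0"
      using tendsto_add[of _ 0 sequentially _ 0] that by (fastforce simp: Exh_def)
    show "\<forall>\<^sub>F n in sequentially. \<phi> (A \<union> B - {0..n}) \<le> \<phi> (A - {0..n}) + \<phi> (B - {0..n})"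
      by (simp add: Un_Diff Un)
  qed simp
  have "is_filter (\<lambda>P. Collect P \<in> dual (Exh \<phi>))"
  proof
    show "Collect (\<lambda>_. True) \<in> dual (Exh \<phi>)"
      by (simp add: dual_def Exh_def empty)
  next
    fix P Q assume "Collect P \<in> dual (Exh \<phi>)" "Collect Q \<in> dual (Exh \<phi>)"
    then show "{x. P x \<and> Q x} \<in> dual (Exh \<phi>)"
      using union by (simp add: dual_def Collect_conj_eq)
  next
    fix P Q assume "\<forall>x. P x \<longrightarrow> Q x" "Collect P \<in> dual (Exh \<phi>)"
    then show "Collect Q \<in> dual (Exh \<phi>)"
      using down[of "- Collect P" "- Collect Q"] by (auto simp: dual_def)
  qed
  then show ?thesis
    using assms(2) by (simp add: set_ideal_def set_filter_def dual_def)
qed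

lemma submeasure_SUP:
  assumes "\<And>n. finite (supp (\<mu> n))" "\<And>n k. 0 \<le> \<mu> n k"
    and bound: "\<And>k. (SUP n. ennreal (fs_value (\<mu> n) {k})) < \<infinity>"
  shows "submeasure (\<lambda>A. SUP n. ennreal (fs_value (\<mu> n) A))"
  unfolding submeasure_def
proof (intro conjI allI)
  show "(SUP n. ennreal (fs_value (\<mu> n) {})) = 0"
    by (simp add: fs_value_def)
  fix A B
  show "(SUP n. ennreal (fs_value (\<mu> n) A)) \<le> (SUP n. ennreal (fs_value (\<mu> n) (A \<union> B)))"
    using assms by (intro SUP_mono' ennreal_leI fs_value_mono) auto
  show "(SUP n. ennreal (fs_value (\<mu> n) (A \<union> B))) \<le>
      (SUP n. ennreal (fs_value (\<mu> n) A)) + (SUP n. ennreal (fs_value (\<mu> n) B))"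
  proof (rule SUP_least)
    fix n
    have "ennreal (fs_value (\<mu> n) (A \<union> B)) \<le> ennreal (fs_value (\<mu> n) A) + ennreal (fs_value (\<mu> n) B)"
      using fs_value_Un[of "\<mu> n" A B] assms(1,2)
      by (simp add: fs_value_nonneg ennreal_leI flip: ennreal_plus)
    also have "\<dots> \<le> (SUP n. ennreal (fs_value (\<mu> n) A)) + (SUP n. ennreal (fs_value (\<mu> n) B))"
      by (intro add_mono SUP_upper) auto
    finally show "ennreal (fs_value (\<mu> n) (A \<union> B)) \<le> \<dots>" .
  qed
qed (rule bound)

text \<open>Cutting the \<open>\<nu> (r j)\<close> down to consecutive blocks costs each less than
  half its mass. The blocks make supports disjoint, and the remaining mass, found arbitrarily far
  out, keeps the ideal of the supremum proper.\<close>

lemma concentrating_imp_density_ideal: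
  assumes F: "free_filter F" and conc: "concentrating F \<nu>"
  shows "\<exists>I. density_ideal I \<and> F \<subseteq> dual I"
proof -
  have fin: "finite (supp (\<nu> n))" and nonneg: "0 \<le> \<nu> n k" and one: "fs_value (\<nu> n) UNIV = 1"
    and lim: "A \<in> F \<Longrightarrow> (\<lambda>n. fs_value (\<nu> n) (- A)) \<longlonglongrightarrow> 0" for n k A
    using conc by (auto simp: concentrating_def)
  have filt: "set_filter F" and free: "\<Inter>F = {}"
    using F by (auto simp: free_filter_def)
  \<comment> \<open>Freeness puts every \<open>- {k}\<close> into \<open>F\<close>, so point masses
    vanish in the limit.\<close>
  have lim0: "(\<lambda>n. \<nu> n k) \<longlonglongrightarrow> 0" for k
  proof -
    obtain A where "A \<in> F" "k \<notin> A" using free by blast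
    then have "- {k} \<in> F" using set_filterD(4)[OF filt, of A "- {k}"] by auto
    moreover have "fs_value (\<nu> n) {k} = \<nu> n k" for n
      using fs_value_superset[of "insert k (supp (\<nu> n))" "\<nu> n" "{k}"] fin by auto
    ultimately show ?thesis using lim[of "- {k}"] by simp
  qed
  obtain r N where N: "strict_mono N" "N 0 = 0" and r: "\<And>j. N j \<le> r j"
    "\<And>j. supp (\<nu> (r j)) \<subseteq> {..<N (Suc j)}" "\<And>j. (\<Sum>k<N j. \<bar>\<nu> (r j) k\<bar>) < 1 / 2"
    by (rule gliding_hump[OF fin lim0, of "\<lambda>_. True" "1 / 2"]) auto
  obtain i where i: "\<And>j k. N j \<le> k \<Longrightarrow> k < N (Suc j) \<Longrightarrow> i k = j"
    using strict_mono_block_index[OF N] by blast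
  define \<mu> where "\<mu> j k = (if k \<in> {N j..<N (Suc j)} then \<nu> (r j) k else 0)" for j k
  define \<phi> where "\<phi> A = (SUP j. ennreal (fs_value (\<mu> j) A))" for A
  have fin\<mu>: "finite (supp (\<mu> j))" and nonneg\<mu>: "0 \<le> \<mu> j k" for j k
    using fin[of "r j"] nonneg by (auto simp: \<mu>_def supp_def)
  have supp\<mu>: "supp (\<mu> j) \<subseteq> {N j..<N (Suc j)}" for j
    by (auto simp: \<mu>_def supp_def)
  have val\<mu>: "fs_value (\<mu> j) A = fs_value (\<nu> (r j)) ({N j..<N (Suc j)} \<inter> A)" for j A
    unfolding \<mu>_def[abs_def] by (rule fs_value_restrict[OF fin])
  have le: "fs_value (\<mu> j) A \<le> fs_value (\<nu> (r j)) A" for j A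
    unfolding val\<mu> by (intro fs_value_mono fin nonneg) auto
  have le1: "fs_value (\<mu> j) A \<le> 1" for j A
    using le[of j A] fs_value_mono[OF fin nonneg, of "r j" A UNIV] one by simp
  have ge: "1 / 2 \<le> fs_value (\<mu> j) UNIV" for j
  proof -
    have "1 = fs_value (\<nu> (r j)) ({..<N j} \<union> {N j..<N (Suc j)})"
      unfolding one[of "r j", symmetric] fs_value_def using r(2)[of j] by (intro sum.cong) auto
    also have "\<dots> \<le> fs_value (\<nu> (r j)) {..<N j} + fs_value (\<mu> j) UNIV"
      unfolding val\<mu> Int_UNIV_right by (intro fs_value_Un fin nonneg)
    also have "fs_value (\<nu> (r j)) {..<N j} \<le> (\<Sum>k<N j. \<bar>\<nu> (r j) k\<bar>)"
      unfolding fs_value_def using nonneg by (simp add: sum_mono2)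
    finally show ?thesis using r(3)[of j] by simp
  qed
  have "\<phi> A \<le> 1" for A
    unfolding \<phi>_def using le1 by (intro SUP_least) simp
  then have sub: "submeasure \<phi>"
    unfolding \<phi>_def by (intro submeasure_SUP fin\<mu> nonneg\<mu>) (auto intro: le_less_trans[OF _ ennreal_one_less_top])
  have "density_submeasure \<phi>"
    unfolding density_submeasure_def
  proof (intro conjI exI[of _ \<mu>] sub)
    show "disjoint_family (\<lambda>j. supp (\<mu> j))"
      unfolding disjoint_family_on_def
    proof (intro ballI impI equals0I)
      fix a b k assume "a \<noteq> b" "k \<in> supp (\<mu> a) \<inter> supp (\<mu> b)"
      then show False by (metis IntD1 IntD2 atLeastLessThan_iff i subsetD supp\<mu>)
    qed
    show "\<phi> = (\<lambda>A. SUP j. ennreal (fs_value (\<mu> j) A))" by (rule ext) (rule \<phi>_def)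
  qed (simp add: fs_measure_def fin\<mu> nonneg\<mu>)
  moreover have "UNIV \<notin> Exh \<phi>"
  proof
    assume "UNIV \<in> Exh \<phi>"
    then have "(\<lambda>n. \<phi> (UNIV - {0..n})) \<longlonglongrightarrow> 0" by (simp add: Exh_def)
    \<comment> \<open>Block \<open>Suc n\<close> starts beyond \<open>n\<close>, so the tail keeps
      the full mass of \<open>\<mu> (Suc n)\<close>.\<close>
    moreover have "ennreal (1 / 2) \<le> \<phi> (UNIV - {0..n})" for n
    proof -
      have "n < N (Suc n)" using strict_mono_imp_increasing[OF N(1), of "Suc n"] by simp
      then have "fs_value (\<mu> (Suc n)) UNIV \<le> fs_value (\<mu> (Suc n)) (UNIV - {0..n})"
        using supp\<mu>[of "Suc n"] by (intro fs_value_mono fin\<mu> nonneg\<mu>) auto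
      then have "ennreal (1 / 2) \<le> ennreal (fs_value (\<mu> (Suc n)) (UNIV - {0..n}))"
        using ge[of "Suc n"] by (intro ennreal_leI) simp
      then show ?thesis unfolding \<phi>_def by (rule SUP_upper2[OF UNIV_I])
    qed
    ultimately have "ennreal (1 / 2) \<le> 0" by (intro LIMSEQ_le_const) auto
    then show False by simp
  qed
  moreover have "F \<subseteq> dual (Exh \<phi>)"
  proof
    fix A assume A: "A \<in> F"
    have "filterlim r sequentially sequentially"
    proof (rule filterlim_at_top_mono)
      show "filterlim N sequentially sequentially" using N(1) by (rule filterlim_subseq)
    qed (simp add: r)
    then have lr: "(\<lambda>j. fs_value (\<nu> (r j)) (- A)) \<longlonglongrightarrow> 0"
      by (rule filterlim_compose[OF lim[OF A]])
    have "(\<lambda>n. \<phi> (- A - {0..n})) \<longlonglongrightarrow> 0"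
    proof (rule order_tendstoI)
      fix a :: ennreal assume "0 < a"
      \<comment> \<open>A supremum of values below \<open>e\<close> is only \<open>\<le> e\<close>,
        so room is left between \<open>e\<close> and \<open>a\<close>.\<close>
      then obtain e where e: "0 < e" "ennreal e < a" by (rule ennreal_real_between)
      from order_tendstoD(2)[OF lr this(1)] obtain J where
        J: "\<And>j. J \<le> j \<Longrightarrow> fs_value (\<nu> (r j)) (- A) < e"
        by (auto simp: eventually_sequentially)
      \<comment> \<open>Measures with \<open>j < J\<close> are supported below \<open>N J\<close>
        and miss the tail; the others already have value below \<open>e\<close> on all of
        \<open>- A\<close>.\<close>
      have "\<phi> (- A - {0..n}) < a" if n: "N J \<le> n" for n
      proof (rule le_less_trans[OF _ e(2)], unfold \<phi>_def, rule SUP_least, rule ennreal_leI)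
        fix j
        show "fs_value (\<mu> j) (- A - {0..n}) \<le> e"
        proof (cases "J \<le> j")
          case True
          have "fs_value (\<mu> j) (- A - {0..n}) \<le> fs_value (\<mu> j) (- A)"
            by (intro fs_value_mono fin\<mu> nonneg\<mu>) auto
          with le[of j "- A"] J[OF True] show ?thesis by simp
        next
          case False
          then have "N (Suc j) \<le> n"
            using n strict_mono_less_eq[OF N(1), of "Suc j" J] by simp
          then have "supp (\<mu> j) \<inter> (- A - {0..n}) = {}"
            using supp\<mu>[of j] by auto
          then show ?thesis using e(1) by (simp add: fs_value_def)
        qed
      qed
      then show "\<forall>\<^sub>F n in sequentially. \<phi> (- A - {0..n}) < a"
        by (auto simp: eventually_sequentially)
    qed simp
    then show "A \<in> dual (Exh \<phi>)" by (simp add: dual_def Exh_def)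
  qed
  ultimately show ?thesis
    using set_ideal_Exh[OF sub] by (auto simp: density_ideal_def)
qed

text \<open>The \<open>\<mu> n\<close> are themselves finite measures below \<open>\<phi>\<close>
  with supremum \<open>\<phi>\<close>. Semicontinuity holds because each finitely supported value is
  attained at a finite truncation.\<close>

lemma density_ideal_imp_nonpathological_ideal:
  assumes "density_ideal I"
  shows "nonpathological_ideal I"
proof -
  obtain \<phi> where I: "set_ideal I" "I = Exh \<phi>" and ds: "density_submeasure \<phi>"
    using assms by (auto simp: density_ideal_def)
  then obtain \<mu> :: "nat \<Rightarrow> nat \<Rightarrow> real" where \<mu>: "\<And>n. fs_measure UNIV (\<mu> n) \<and> (\<forall>k. 0 \<le> \<mu> n k)"
    and \<phi>: "\<And>A. \<phi> A = (SUP n. ennreal (fs_value (\<mu> n) A))"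
    unfolding density_submeasure_def by metis
  have sub: "submeasure \<phi>" using ds by (simp add: density_submeasure_def)
  have fin: "finite (supp (\<mu> n))" and nonneg: "0 \<le> \<mu> n k" for n k
    using \<mu> by (auto simp: fs_measure_def)
  have mono: "A \<subseteq> B \<Longrightarrow> \<phi> A \<le> \<phi> B" for A B
    using sub unfolding submeasure_def by (metis Un_absorb1)
  have "lsc \<phi>"
    unfolding lsc_def
  proof
    fix A
    have "(SUP n. \<phi> (A \<inter> {0..n})) = \<phi> A"
    proof (rule antisym)
      show "(SUP n. \<phi> (A \<inter> {0..n})) \<le> \<phi> A" by (intro SUP_least mono) auto
      have "\<exists>n. ennreal (fs_value (\<mu> j) A) \<le> \<phi> (A \<inter> {0..n})" for j
      proof -
        obtain b where "\<forall>k\<in>supp (\<mu> j). k \<le> b"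
          using fin finite_nat_set_iff_bounded_le by blast
        then have "ennreal (fs_value (\<mu> j) A) \<le> ennreal (fs_value (\<mu> j) (A \<inter> {0..b}))"
          by (intro ennreal_leI fs_value_mono fin nonneg) auto
        also have "\<dots> \<le> \<phi> (A \<inter> {0..b})" unfolding \<phi> by (intro SUP_upper) auto
        finally show ?thesis by blast
      qed
      then show "\<phi> A \<le> (SUP n. \<phi> (A \<inter> {0..n}))"
        unfolding \<phi>[of A] by (intro SUP_mono) auto
    qed
    moreover have "incseq (\<lambda>n. \<phi> (A \<inter> {0..n}))"
      by (intro incseq_SucI mono) auto
    ultimately show "(\<lambda>n. \<phi> (A \<inter> {0..n})) \<longlonglongrightarrow> \<phi> A"
      using LIMSEQ_SUP by metis
  qed
  moreover have "nonpathological \<phi>"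
    unfolding nonpathological_def
  proof (intro allI antisym)
    fix A
    let ?D = "\<lambda>M. sets M = UNIV \<and> finite_measure M \<and> (\<forall>B. emeasure M B \<le> \<phi> B)"
    show "\<phi> A \<le> Sup {emeasure M A | M :: nat measure. ?D M}"
      unfolding \<phi>[of A]
    proof (rule SUP_least)
      fix j
      \<comment> \<open>The weight function is turned into a measure on all subsets via its density
        against counting measure.\<close>
      define M where "M = density (count_space UNIV) (\<lambda>k. ennreal (\<mu> j k))"
      have em: "emeasure M B = ennreal (fs_value (\<mu> j) B)" for B
      proof -
        have "emeasure M B = (\<integral>\<^sup>+ k. ennreal (\<mu> j k) * indicator B k \<partial>count_space UNIV)"
          unfolding M_def by (rule emeasure_density) auto
        also have "\<dots> = (\<Sum>k\<in>supp (\<mu> j) \<inter> B. ennreal (\<mu> j k) * indicator B k)"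
          using fin[of j] by (intro nn_integral_count_space') (auto simp: supp_def indicator_def)
        also have "\<dots> = (\<Sum>k\<in>supp (\<mu> j) \<inter> B. ennreal (\<mu> j k))"
          by (intro sum.cong) auto
        also have "\<dots> = ennreal (fs_value (\<mu> j) B)"
          unfolding fs_value_def by (intro sum_ennreal nonneg)
        finally show ?thesis .
      qed
      have "?D M"
        unfolding em \<phi> by (auto intro!: finite_measureI SUP_upper simp: em) (simp_all add: M_def)
      then show "ennreal (fs_value (\<mu> j) A) \<le> Sup {emeasure M A | M :: nat measure. ?D M}"
        by (intro Sup_upper CollectI exI[of _ M]) (simp add: em)
    qed
  qed (auto intro: Sup_least)
  ultimately show ?thesis
    using I sub unfolding nonpathological_ideal_def by blast
qed

text \<open>Non-pathology supplies, for each \<open>n\<close>, a measure below \<open>\<phi>\<close>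
  with mass above a fixed \<open>d\<close> beyond \<open>n\<close>. Restricted there, it is
  dominated by \<open>\<phi> (B - {0..n})\<close>, which tends to 0 when \<open>B\<close> is the
  complement of a set in \<open>F\<close>.\<close>

lemma nonpathological_ideal_imp_concentrating:
  assumes "nonpathological_ideal I" "F \<subseteq> dual I"
  shows "\<exists>\<nu>. concentrating F \<nu>"
proof -
  obtain \<phi> where I: "set_ideal I" "I = Exh \<phi>" and sub: "submeasure \<phi>" and np: "nonpathological \<phi>"
    using assms(1) by (auto simp: nonpathological_ideal_def)
  have mono: "A \<subseteq> B \<Longrightarrow> \<phi> A \<le> \<phi> B" for A B
    using sub unfolding submeasure_def by (metis Un_absorb1)
  have "UNIV \<notin> Exh \<phi>"
    using I by (auto simp: set_ideal_def set_filter_def dual_def)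
  \<comment> \<open>The tail values decrease to their infimum; were it 0, \<open>UNIV\<close> would
    lie in \<open>Exh \<phi>\<close>.\<close>
  moreover have "(\<lambda>n. \<phi> (UNIV - {0..n})) \<longlonglongrightarrow> (INF n. \<phi> (UNIV - {0..n}))"
    by (intro LIMSEQ_INF decseq_SucI mono) auto
  ultimately have "0 < (INF n. \<phi> (UNIV - {0..n}))"
    by (auto simp: Exh_def zero_less_iff_neq_zero)
  then obtain d where d: "0 < d" "ennreal d < (INF n. \<phi> (UNIV - {0..n}))"
    by (rule ennreal_real_between)
  have "\<exists>\<nu>. finite (supp \<nu>) \<and> (\<forall>k. 0 \<le> \<nu> k) \<and> d \<le> fs_value \<nu> UNIV \<and>
      (\<forall>B. ennreal (fs_value \<nu> B) \<le> \<phi> (B - {0..n}))" for n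
  proof -
    have "ennreal d < \<phi> (UNIV - {0..n})"
      using d(2) by (rule less_le_trans) (rule INF_lower, simp)
    from this np[unfolded nonpathological_def, THEN spec, of "UNIV - {0..n}"]
    have "ennreal d < Sup {emeasure M (UNIV - {0..n}) | M :: nat measure.
        sets M = UNIV \<and> finite_measure M \<and> (\<forall>B. emeasure M B \<le> \<phi> B)}"
      by (rule ord_less_eq_trans)
    then obtain M :: "nat measure" where M: "sets M = UNIV" "finite_measure M"
      "\<And>B. emeasure M B \<le> \<phi> B" "ennreal d < emeasure M (UNIV - {0..n})"
      unfolding less_Sup_iff by blast
    interpret finite_measure M by fact
    \<comment> \<open>By continuity from below, a finite piece of the tail already has mass above
      \<open>d\<close>, which yields finite support.\<close>
    have "(\<lambda>m. emeasure M ({..m} - {0..n})) \<longlonglongrightarrow> emeasure M (\<Union>m. {..m} - {0..n})"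
      by (intro Lim_emeasure_incseq) (auto simp: M(1) incseq_def)
    also have "(\<Union>m. {..m} - {0..n}) = UNIV - {0..n}" by auto
    finally have "\<forall>\<^sub>F m in sequentially. ennreal d < emeasure M ({..m} - {0..n})"
      using M(4) by (rule order_tendstoD)
    then obtain m where m: "ennreal d < emeasure M ({..m} - {0..n})"
      by (auto dest: eventually_happens)
    let ?\<nu> = "\<lambda>k. if k \<in> {..m} - {0..n} then measure M {k} else 0"
    have val: "fs_value ?\<nu> B = measure M (({..m} - {0..n}) \<inter> B)" for B
    proof -
      have "fs_value ?\<nu> B = sum ?\<nu> (({..m} - {0..n}) \<inter> B)"
        by (rule fs_value_superset) (auto simp: supp_def)
      also have "\<dots> = (\<Sum>k\<in>({..m} - {0..n}) \<inter> B. measure M {k})"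
        by (intro sum.cong) auto
      also have "\<dots> = measure M (({..m} - {0..n}) \<inter> B)"
        by (rule finite_measure_eq_sum_singleton[symmetric]) (auto simp: M(1))
      finally show ?thesis .
    qed
    have "finite (supp ?\<nu>)"
      by (rule finite_subset[of _ "{..m}"]) (auto simp: supp_def)
    moreover have "d \<le> fs_value ?\<nu> UNIV"
      unfolding val using m d(1) by (simp add: emeasure_eq_measure ennreal_less_iff)
    moreover have "ennreal (fs_value ?\<nu> B) \<le> \<phi> (B - {0..n})" for B
    proof -
      have "ennreal (fs_value ?\<nu> B) \<le> \<phi> (({..m} - {0..n}) \<inter> B)"
        unfolding val emeasure_eq_measure[symmetric] by (rule M(3))
      also have "\<dots> \<le> \<phi> (B - {0..n})" by (rule mono) auto
      finally show ?thesis .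
    qed
    ultimately show ?thesis by (intro exI[of _ ?\<nu>]) auto
  qed
  then obtain \<nu> where \<nu>: "\<And>n. finite (supp (\<nu> n))" "\<And>n k. 0 \<le> \<nu> n k"
    "\<And>n. d \<le> fs_value (\<nu> n) UNIV" "\<And>n B. ennreal (fs_value (\<nu> n) B) \<le> \<phi> (B - {0..n})"
    by metis
  show ?thesis
  proof (rule concentrating_normalize[OF \<nu>(1,2) d(1) \<nu>(3)])
    fix A assume "A \<in> F"
    then have "(\<lambda>n. \<phi> (- A - {0..n})) \<longlonglongrightarrow> 0"
      using assms(2) I(2) by (auto simp: dual_def Exh_def)
    then have "(\<lambda>n. ennreal (fs_value (\<nu> n) (- A))) \<longlonglongrightarrow> ennreal 0"
      unfolding ennreal_0
      by (rule tendsto_sandwich[OF _ _ tendsto_const, rotated 2]) (auto intro!: always_eventually \<nu>(4))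
    then show "(\<lambda>n. fs_value (\<nu> n) (- A)) \<longlonglongrightarrow> 0"
      by (rule tendsto_ennrealD) (auto intro!: always_eventually fs_value_nonneg \<nu>(2))
  qed
qed

section \<open>Concentrating sequences and asymptotic density\<close>

lemma asymptotic_density_ideal_iff:
  "A \<in> asymptotic_density_ideal \<longleftrightarrow> (\<lambda>n. real (card (A \<inter> {0..<n})) / real n) \<longlonglongrightarrow> 0"
proof
  assume "A \<in> asymptotic_density_ideal"
  then have "limsup (\<lambda>n. ereal (real (card (A \<inter> {0..<n})) / real n)) = 0"
    by (simp add: asymptotic_density_ideal_def)
  moreover have "0 \<le> liminf (\<lambda>n. ereal (real (card (A \<inter> {0..<n})) / real n))"
    by (intro Liminf_bounded) simp
  ultimately show "(\<lambda>n. real (card (A \<inter> {0..<n})) / real n) \<longlonglongrightarrow> 0"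
    by (intro limsup_le_liminf_real) (simp_all add: zero_ereal_def)
next
  assume "(\<lambda>n. real (card (A \<inter> {0..<n})) / real n) \<longlonglongrightarrow> 0"
  then have "(\<lambda>n. ereal (real (card (A \<inter> {0..<n})) / real n)) \<longlonglongrightarrow> ereal 0" by simp
  from lim_imp_Limsup[OF sequentially_bot this] show "A \<in> asymptotic_density_ideal"
    by (simp add: asymptotic_density_ideal_def zero_ereal_def)
qed

text \<open>Block counts add up like a geometric series, so the count below \<open>2^m\<close> is
  controlled by the last block; a general \<open>n\<close> lies within a factor 2 of a power of
  2.\<close>

lemma asymptotic_density_idealI_dyadic:
  assumes "(\<lambda>m. real (card (A \<inter> {2^m..<2^Suc m})) / 2^m) \<longlonglongrightarrow> 0"
  shows "A \<in> asymptotic_density_ideal"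
  unfolding asymptotic_density_ideal_iff
proof (rule LIMSEQ_I)
  fix e :: real assume e: "0 < e"
  from LIMSEQ_D[OF assms, of "e / 4"] obtain M where
    M: "\<And>m. M \<le> m \<Longrightarrow> real (card (A \<inter> {2^m..<2^Suc m})) / 2^m < e / 4"
    using e by auto
  \<comment> \<open>The summand \<open>2^M\<close> absorbs all blocks before \<open>M\<close>; each
    later one adds at most \<open>e / 4 * 2^m\<close>, doubling the second summand.\<close>
  have block: "real (card (A \<inter> {0..<2^m})) \<le> 2^M + e / 4 * 2^m" for m
  proof (induction m)
    case 0
    have "card (A \<inter> {0..<2^0}) \<le> card {0..<1::nat}" by (intro card_mono) auto
    then have "real (card (A \<inter> {0..<2^0})) \<le> 1" by simp
    also have "(1::real) \<le> 2^M + e / 4 * 2^0" using e by (simp add: add_increasing2)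
    finally show ?case .
  next
    case (Suc m)
    show ?case
    proof (cases "M \<le> m")
      case True
      have "A \<inter> {0..<2^Suc m} \<subseteq> A \<inter> {0..<2^m} \<union> A \<inter> {2^m..<2^Suc m}" by auto
      then have "card (A \<inter> {0..<2^Suc m}) \<le> card (A \<inter> {0..<2^m}) + card (A \<inter> {2^m..<2^Suc m})"
        by (intro order.trans[OF card_mono card_Un_le]) auto
      moreover have "real (card (A \<inter> {2^m..<2^Suc m})) \<le> e / 4 * 2^m"
        using M[OF True] by (simp add: field_simps)
      ultimately show ?thesis using Suc.IH by simp
    next
      case False
      have "card (A \<inter> {0..<2^Suc m}) \<le> card {0..<2^Suc m::nat}" by (intro card_mono) auto
      also have "\<dots> \<le> 2^M" using False by (simp del: power_Suc)
      finally have "real (card (A \<inter> {0..<2^Suc m})) \<le> 2^M"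
        by (metis of_nat_le_iff of_nat_numeral of_nat_power)
      then show ?thesis using e by (simp add: add_increasing2)
    qed
  qed
  obtain n0 :: nat where n0: "2^M * 2 / e < real n0" using reals_Archimedean2 by blast
  \<comment> \<open>Rounding \<open>n\<close> up to \<open>2^Suc m\<close> turns
    \<open>e / 4\<close> into \<open>e / 2\<close>; \<open>n0\<close> makes \<open>2^M\<close> cost
    less than another \<open>e / 2 * real n\<close>. The 1 in the maximum keeps \<open>n\<close>
    positive for \<open>floor_log\<close> and the division.\<close>
  have "real (card (A \<inter> {0..<n})) / real n < e" if n: "max 1 n0 \<le> n" for n
  proof -
    define m where "m = floor_log n"
    have m: "2^m \<le> n" "n < 2^Suc m"
      using n floor_log_exp2_le[of n] floor_log_exp2_gt[of n] by (simp_all add: m_def)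
    have "card (A \<inter> {0..<n}) \<le> card (A \<inter> {0..<2^Suc m})"
      using m(2) by (intro card_mono) auto
    then have "real (card (A \<inter> {0..<n})) \<le> 2^M + e / 4 * 2^Suc m"
      using block[of "Suc m"] by linarith
    also have "e / 4 * 2^Suc m \<le> e / 2 * real n"
    proof -
      have "(2::real)^m \<le> real n" using m(1) by (metis of_nat_le_iff of_nat_numeral of_nat_power)
      then show ?thesis using e by (simp add: mult_left_mono)
    qed
    also have "2^M < e / 2 * real n"
    proof -
      have "2^M * 2 / e < real n" using n0 n by simp
      then show ?thesis using e by (simp add: field_simps)
    qed
    finally show ?thesis using n by (simp add: field_simps)
  qed
  then show "\<exists>n0. \<forall>n\<ge>n0. norm (real (card (A \<inter> {0..<n})) / real n - 0) < e"
    by (intro exI[of _ "max 1 n0"]) auto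
qed

text \<open>The push-forward under \<open>f\<close> of the uniform measure on \<open>{0..n}\<close>
  gives \<open>- A\<close> the relative frequency of its preimage, which has density 0.\<close>

lemma katetov_le_density_imp_concentrating:
  assumes "katetov_le F (dual asymptotic_density_ideal)"
  shows "\<exists>\<nu>. concentrating F \<nu>"
proof -
  obtain f :: "nat \<Rightarrow> nat" where f: "\<And>A. A \<in> F \<Longrightarrow> f -` (- A) \<in> asymptotic_density_ideal"
    using assms by (auto simp: katetov_le_def dual_def vimage_Compl)
  \<comment> \<open>\<open>Suc n\<close> keeps the sampled interval nonempty, so each measure has
    mass 1.\<close>
  define \<nu> where "\<nu> n k = real (card (f -` {k} \<inter> {0..<Suc n})) / real (Suc n)" for n k
  have supp: "supp (\<nu> n) \<subseteq> f ` {0..<Suc n}" for n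
  proof
    fix k assume "k \<in> supp (\<nu> n)"
    then have "f -` {k} \<inter> {0..<Suc n} \<noteq> {}" unfolding supp_def \<nu>_def by force
    then show "k \<in> f ` {0..<Suc n}" by auto
  qed
  have val: "fs_value (\<nu> n) B = real (card (f -` B \<inter> {0..<Suc n})) / real (Suc n)" for n B
  proof -
    have "fs_value (\<nu> n) B = (\<Sum>k\<in>f ` {0..<Suc n} \<inter> B. \<nu> n k)"
      by (rule fs_value_superset[OF _ supp]) simp
    also have "\<dots> = real (\<Sum>k\<in>f ` {0..<Suc n} \<inter> B. card (f -` {k} \<inter> {0..<Suc n})) / real (Suc n)"
      by (simp add: \<nu>_def sum_divide_distrib)
    also have "(\<Sum>k\<in>f ` {0..<Suc n} \<inter> B. card (f -` {k} \<inter> {0..<Suc n})) =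
        card (\<Union>k\<in>f ` {0..<Suc n} \<inter> B. f -` {k} \<inter> {0..<Suc n})"
      by (rule card_UN_disjoint[symmetric]) auto
    also have "(\<Union>k\<in>f ` {0..<Suc n} \<inter> B. f -` {k} \<inter> {0..<Suc n}) = f -` B \<inter> {0..<Suc n}"
      by auto
    finally show ?thesis .
  qed
  have "(\<lambda>n. fs_value (\<nu> n) (- A)) \<longlonglongrightarrow> 0" if "A \<in> F" for A
    unfolding val using f[OF that] unfolding asymptotic_density_ideal_iff by (rule LIMSEQ_Suc)
  moreover have "finite (supp (\<nu> n))" for n
    using supp by (rule finite_subset) simp
  moreover have "fs_value (\<nu> n) UNIV = 1" for n by (simp add: val)
  ultimately have "concentrating F \<nu>"
    by (simp add: concentrating_def \<nu>_def)
  then show ?thesis by blast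
qed

text \<open>
  Sampling the quantile function of \<open>\<nu>\<close> at the points \<open>i / L\<close> hits \<open>k\<close> as often as \<open>i / L\<close> falls
  into a half-open interval of length \<open>\<nu> k\<close>.
\<close>

lemma quantile_sampling:
  fixes \<nu> :: "nat \<Rightarrow> real" and L :: nat
  assumes fin: "finite (supp \<nu>)" and nonneg: "\<And>k. 0 \<le> \<nu> k" and one: "fs_value \<nu> UNIV = 1"
    and L: "0 < L"
  shows "\<exists>g::nat \<Rightarrow> nat. \<forall>B. real (card (g -` B \<inter> {0..<L})) \<le> real L * fs_value \<nu> B + real (card (supp \<nu>))"
proof -
  define S where "S k = (\<Sum>j<k. \<nu> j)" for k
  have S: "S 0 = 0" "S (Suc k) = S k + \<nu> k" for k by (simp_all add: S_def)
  obtain b where b: "\<forall>k\<in>supp \<nu>. k \<le> b"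
    using fin finite_nat_set_iff_bounded_le by blast
  then have "supp \<nu> \<subseteq> {..<Suc b}" by (auto simp: less_Suc_eq_le)
  then have "S (Suc b) = 1"
    using fs_value_superset[of "{..<Suc b}" \<nu> UNIV] one by (simp add: S_def)
  \<comment> \<open>\<open>S\<close> is the cumulative distribution, with value 1 at
    \<open>Suc b\<close>, so for \<open>i < L\<close> the least \<open>k\<close> exists and is the
    quantile at \<open>i / L\<close>.\<close>
  define g where "g i = (LEAST k. real i / real L < S (Suc k))" for i
  have g: "S (g i) \<le> real i / real L \<and> real i / real L < S (Suc (g i))" if "i < L" for i
  proof
    have "real i / real L < S (Suc b)"
      using that by (simp add: \<open>S (Suc b) = 1\<close>)
    then show "real i / real L < S (Suc (g i))"
      unfolding g_def by (rule LeastI)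
    show "S (g i) \<le> real i / real L"
    proof (cases "g i")
      case (Suc k)
      then have "\<not> real i / real L < S (Suc k)"
        unfolding g_def by (intro not_less_Least) simp
      with Suc show ?thesis by simp
    qed (simp add: S)
  qed
  have fiber: "real (card (g -` {k} \<inter> {0..<L})) \<le> real L * \<nu> k + 1" for k
  proof -
    \<comment> \<open>The fiber consists of integers in a half-open interval of length
      \<open>L * \<nu> k\<close>; counting them by ceilings costs at most 1.\<close>
    have "g -` {k} \<inter> {0..<L} \<subseteq> nat ` {\<lceil>L * S k\<rceil>..<\<lceil>L * S (Suc k)\<rceil>}"
    proof
      fix i assume i: "i \<in> g -` {k} \<inter> {0..<L}"
      then have "L * S k \<le> real i" "real i < L * S (Suc k)"
        using g[of i] L by (auto simp: field_simps)
      then have "int i \<in> {\<lceil>L * S k\<rceil>..<\<lceil>L * S (Suc k)\<rceil>}"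
        by (simp add: ceiling_le_iff less_ceiling_iff)
      then show "i \<in> nat ` {\<lceil>L * S k\<rceil>..<\<lceil>L * S (Suc k)\<rceil>}" by force
    qed
    then have "card (g -` {k} \<inter> {0..<L}) \<le> card {\<lceil>L * S k\<rceil>..<\<lceil>L * S (Suc k)\<rceil>}"
      by (intro order.trans[OF card_mono card_image_le]) auto
    also have "\<dots> = nat (\<lceil>L * S (Suc k)\<rceil> - \<lceil>L * S k\<rceil>)" by simp
    finally have "real (card (g -` {k} \<inter> {0..<L})) \<le> real (nat (\<lceil>L * S (Suc k)\<rceil> - \<lceil>L * S k\<rceil>))"
      by simp
    also have "\<dots> \<le> real L * \<nu> k + 1"
    proof -
      have "L * S k \<le> L * S (Suc k)" using nonneg by (simp add: S mult_left_mono)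
      then have "\<lceil>L * S k\<rceil> \<le> \<lceil>L * S (Suc k)\<rceil>" by (rule ceiling_mono)
      then have "real (nat (\<lceil>L * S (Suc k)\<rceil> - \<lceil>L * S k\<rceil>)) = of_int \<lceil>L * S (Suc k)\<rceil> - of_int \<lceil>L * S k\<rceil>"
        by simp
      also have "\<dots> \<le> L * S (Suc k) + 1 - L * S k"
        using ceiling_correct[of "L * S (Suc k)"] ceiling_correct[of "L * S k"] by linarith
      finally show ?thesis by (simp add: S distrib_left)
    qed
    finally show ?thesis .
  qed
  have "real (card (g -` B \<inter> {0..<L})) \<le> real L * fs_value \<nu> B + real (card (supp \<nu>))" for B
  proof -
    \<comment> \<open>Quantiles only hit points of positive weight, so the rounding error of 1 is
      paid once per support point.\<close>
    have "g -` B \<inter> {0..<L} \<subseteq> (\<Union>k\<in>supp \<nu> \<inter> B. g -` {k} \<inter> {0..<L})"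
    proof
      fix i assume i: "i \<in> g -` B \<inter> {0..<L}"
      then have "S (g i) < S (Suc (g i))" using g[of i] by force
      then have "g i \<in> supp \<nu>" by (simp add: S supp_def)
      with i show "i \<in> (\<Union>k\<in>supp \<nu> \<inter> B. g -` {k} \<inter> {0..<L})" by auto
    qed
    then have "card (g -` B \<inter> {0..<L}) \<le> (\<Sum>k\<in>supp \<nu> \<inter> B. card (g -` {k} \<inter> {0..<L}))"
      using fin by (intro order.trans[OF card_mono card_UN_le]) auto
    then have "real (card (g -` B \<inter> {0..<L})) \<le> (\<Sum>k\<in>supp \<nu> \<inter> B. real (card (g -` {k} \<inter> {0..<L})))"
      by (simp flip: of_nat_sum)
    also have "\<dots> \<le> (\<Sum>k\<in>supp \<nu> \<inter> B. real L * \<nu> k + 1)"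
      by (intro sum_mono fiber)
    also have "\<dots> = real L * fs_value \<nu> B + real (card (supp \<nu> \<inter> B))"
      by (simp add: sum.distrib fs_value_def sum_distrib_left)
    also have "card (supp \<nu> \<inter> B) \<le> card (supp \<nu>)"
      using fin by (intro card_mono) auto
    finally show ?thesis by simp
  qed
  then show ?thesis by blast
qed

text \<open>Take the largest admissible \<open>n \<le> m\<close>; 0 is always admissible, and each
  \<open>n\<close> becomes so once \<open>m\<close> exceeds \<open>n\<close> and
  \<open>c n * n\<close>, as \<open>m < 2^m\<close>. The extra factor \<open>w m\<close> makes
  \<open>c (w m) / 2^m\<close> at most \<open>1 / w m\<close>.\<close>

lemma slow_reindexing:
  fixes c :: "nat \<Rightarrow> nat"
  obtains w where "filterlim w sequentially sequentially"
    "\<And>m. w m = 0 \<or> c (w m) * w m \<le> 2 ^ m"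
proof
  define w where "w m = Max {n. n \<le> m \<and> (n = 0 \<or> c n * n \<le> 2 ^ m)}" for m
  have fin: "finite {n. n \<le> m \<and> (n = 0 \<or> c n * n \<le> 2 ^ m)}" for m
    by (rule finite_subset[of _ "{..m}"]) auto
  show "w m = 0 \<or> c (w m) * w m \<le> 2 ^ m" for m
    using Max_in[OF fin[of m]] unfolding w_def[symmetric] by auto
  show "filterlim w sequentially sequentially"
    unfolding filterlim_at_top eventually_sequentially
  proof (intro allI exI impI)
    fix n m assume m: "max n (c n * n) \<le> m"
    then have "c n * n \<le> 2 ^ m" using less_exp[of m] by linarith
    with m show "n \<le> w m" unfolding w_def by (intro Max_ge[OF fin]) auto
  qed
qed

text \<open>
  On the dyadic block \<open>[2\<^sup>m, 2\<^bsup>m+1\<^esup>)\<close> the map samples \<open>\<nu>\<^bsub>w m\<^esub>\<close>; the index \<open>w m\<close> grows so slowly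
  that the rounding error, one per support point, is negligible against \<open>2\<^sup>m\<close>.
\<close>

lemma concentrating_imp_katetov_le_density:
  assumes conc: "concentrating F \<nu>"
  shows "katetov_le F (dual asymptotic_density_ideal)"
proof -
  have fin: "finite (supp (\<nu> n))" and nonneg: "0 \<le> \<nu> n k" and one: "fs_value (\<nu> n) UNIV = 1"
    and lim: "A \<in> F \<Longrightarrow> (\<lambda>n. fs_value (\<nu> n) (- A)) \<longlonglongrightarrow> 0" for n k A
    using conc by (auto simp: concentrating_def)
  obtain w where w: "filterlim w sequentially sequentially"
    and small: "\<And>m. w m = 0 \<or> card (supp (\<nu> (w m))) * w m \<le> 2 ^ m"
    by (rule slow_reindexing[of "\<lambda>n. card (supp (\<nu> n))"]) blast
  have "\<exists>g::nat \<Rightarrow> nat. \<forall>B. real (card (g -` B \<inter> {0..<2^m})) \<le>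
      real (2^m) * fs_value (\<nu> (w m)) B + real (card (supp (\<nu> (w m))))" for m
    by (rule quantile_sampling[OF fin nonneg one]) simp
  then obtain g :: "nat \<Rightarrow> nat \<Rightarrow> nat" where g: "\<And>m B. real (card (g m -` B \<inter> {0..<2^m})) \<le>
      real (2^m) * fs_value (\<nu> (w m)) B + real (card (supp (\<nu> (w m))))"
    by metis
  \<comment> \<open>\<open>floor_log i\<close> is the block of \<open>i\<close>, and the subtraction
    its offset there. The point 0 lies in no block and does not enter the counts.\<close>
  define f where "f i = g (floor_log i) (i - 2 ^ floor_log i)" for i
  have "f -` B \<inter> {2^m..<2^Suc m} \<subseteq> (\<lambda>i. 2^m + i) ` (g m -` B \<inter> {0..<2^m})" for B m
  proof
    fix i assume i: "i \<in> f -` B \<inter> {2^m..<2^Suc m}"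
    then have "floor_log i = m" by (intro floor_log_eqI) auto
    then show "i \<in> (\<lambda>i. 2^m + i) ` (g m -` B \<inter> {0..<2^m})"
      using i by (intro image_eqI[of _ _ "i - 2^m"]) (auto simp: f_def)
  qed
  then have card_le: "card (f -` B \<inter> {2^m..<2^Suc m}) \<le> card (g m -` B \<inter> {0..<2^m})" for B m
    by (rule surj_card_le[rotated]) simp
  have count: "real (card (f -` B \<inter> {2^m..<2^Suc m})) / 2^m \<le>
      fs_value (\<nu> (w m)) B + real (card (supp (\<nu> (w m)))) / 2^m" for B m
  proof -
    have "real (card (f -` B \<inter> {2^m..<2^Suc m})) / 2^m \<le>
        (real (2^m) * fs_value (\<nu> (w m)) B + real (card (supp (\<nu> (w m))))) / 2^m"
      by (intro divide_right_mono order.trans[OF of_nat_mono[OF card_le] g]) simp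
    then show ?thesis by (simp add: add_divide_distrib)
  qed
  have round: "(\<lambda>m. real (card (supp (\<nu> (w m)))) / 2^m) \<longlonglongrightarrow> 0"
  proof (rule tendsto_sandwich[OF _ _ tendsto_const])
    show "(\<lambda>m. 1 / real (w m)) \<longlonglongrightarrow> 0"
      by (rule filterlim_compose[OF lim_1_over_n w])
    \<comment> \<open>This excludes the fallback value \<open>w m = 0\<close>, for which
      \<open>small\<close> gives no bound.\<close>
    have "\<forall>\<^sub>F m in sequentially. 1 \<le> w m"
      using w by (simp add: filterlim_at_top)
    then show "\<forall>\<^sub>F m in sequentially. real (card (supp (\<nu> (w m)))) / 2^m \<le> 1 / real (w m)"
    proof eventually_elim
      case (elim m)
      then have "real (card (supp (\<nu> (w m))) * w m) \<le> real (2 ^ m)"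
        using small[of m] by (intro of_nat_mono) auto
      with elim show ?case by (simp add: field_simps)
    qed
  qed simp
  have "f -` A \<in> dual asymptotic_density_ideal" if A: "A \<in> F" for A
  proof -
    have "(\<lambda>m. fs_value (\<nu> (w m)) (- A) + real (card (supp (\<nu> (w m)))) / 2^m) \<longlonglongrightarrow> 0 + 0"
      by (intro tendsto_add filterlim_compose[OF lim[OF A] w] round)
    then have upper: "(\<lambda>m. fs_value (\<nu> (w m)) (- A) + real (card (supp (\<nu> (w m)))) / 2^m) \<longlonglongrightarrow> 0"
      by simp
    have "(\<lambda>m. real (card (f -` (- A) \<inter> {2^m..<2^Suc m})) / 2^m) \<longlonglongrightarrow> 0"
      by (rule tendsto_sandwich[OF always_eventually always_eventually tendsto_const upper])
        (simp, blast intro: count)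
    then have "f -` (- A) \<in> asymptotic_density_ideal"
      by (rule asymptotic_density_idealI_dyadic)
    then show ?thesis by (simp add: dual_def vimage_Compl)
  qed
  then show ?thesis unfolding katetov_le_def by blast
qed

theorem theorem1p3:
  fixes F :: "nat set set"
  assumes "free_filter F"
  shows "(BJNP (NF F) \<longleftrightarrow> (\<exists>I. density_ideal I \<and> F \<subseteq> dual I)) \<and>
         ((\<exists>I. density_ideal I \<and> F \<subseteq> dual I) \<longleftrightarrow> (\<exists>I. nonpathological_ideal I \<and> F \<subseteq> dual I)) \<and>
         ((\<exists>I. nonpathological_ideal I \<and> F \<subseteq> dual I) \<longleftrightarrow> katetov_le F (dual asymptotic_density_ideal))"
proof -
  have F: "set_filter F" using assms by (simp add: free_filter_def)
  \<comment> \<open>Concentrating sequences are the hub: equivalences with the first and last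
    conditions, and a cycle through the two conditions on ideals.\<close>
  have "BJNP (NF F) \<longleftrightarrow> (\<exists>\<nu>. concentrating F \<nu>)"
    using BJNP_NF_imp_concentrating[OF F] concentrating_imp_BJNP_NF[OF F] by blast
  moreover have "(\<exists>\<nu>. concentrating F \<nu>) \<Longrightarrow> \<exists>I. density_ideal I \<and> F \<subseteq> dual I"
    using concentrating_imp_density_ideal[OF assms] by blast
  moreover have "\<exists>I. density_ideal I \<and> F \<subseteq> dual I \<Longrightarrow> \<exists>I. nonpathological_ideal I \<and> F \<subseteq> dual I"
    using density_ideal_imp_nonpathological_ideal by blast
  moreover have "\<exists>I. nonpathological_ideal I \<and> F \<subseteq> dual I \<Longrightarrow> \<exists>\<nu>. concentrating F \<nu>"
    using nonpathological_ideal_imp_concentrating by blast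
  moreover have "katetov_le F (dual asymptotic_density_ideal) \<longleftrightarrow> (\<exists>\<nu>. concentrating F \<nu>)"
    using katetov_le_density_imp_concentrating concentrating_imp_katetov_le_density by blast
  ultimately show ?thesis by argo
qed

end
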